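(* The generating function for the number of spanning trees in the family $\mathcal{P}_2=\{P_n^2 : n\ge 4\}$ is, as a formal power series, $$\sum_{m=0}^{\infty}\tau(P_{m+4}^2)\,t^m=\frac{-3t+8}{t^{2} - 3t + 1}.$$
   Context: All graphs are finite and simple. $P_n$ is the path graph on $n$ vertices. For a graph $G$ and $k\ge1$, the $k$-th power $G^k$ has $V(G^k)=V(G)$, and $uv$ is an edge iff the distance between $u$ and $v$ in $G$ is at least $1$ and at most $k$. $\tau(G)$ is the number of labeled spanning trees of $G$ (isomorphic trees with different labels are counted as different). The family is $\mathcal{P}_k=\{P_n^k : k<\operatorname{diam} P_n\}=\{P_n^k : n\ge k+2\}$; the sequence is indexed so that the constant term of the generating function corresponds to the smallest member $n=k+2$. *)

theory Defs
  imports
    "Graph_Theory.Digraph_Component"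
    "Graph_Theory.Shortest_Path"
    "HOL-Computational_Algebra.Formal_Power_Series"
begin

text \<open>
  Finite simple graphs are the instances of the locale \<^locale>\<open>pair_graph\<close>: an undirected
  edge between \<open>u\<close> and \<open>v\<close> is the pair of arcs \<open>(u, v)\<close>, \<open>(v, u)\<close>.
\<close>

definition path_graph :: "nat \<Rightarrow> nat pair_pre_digraph" where
  "path_graph n =
     \<lparr>pverts = {..<n}, parcs = {(i, j). i < n \<and> j < n \<and> (j = Suc i \<or> i = Suc j)}\<rparr>"

lemma pair_graph_path_graph: "pair_graph (path_graph n)"
proof unfold_locales
  show "finite (parcs (path_graph n))"
    by (rule finite_subset[of _ "{..<n} \<times> {..<n}"]) (auto simp: path_graph_def)
qed (auto simp: path_graph_def symmetric_def sym_def)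

definition graph_dist :: "'a pair_pre_digraph \<Rightarrow> 'a \<Rightarrow> 'a \<Rightarrow> ereal" where
  "graph_dist G u v = wf_digraph.\<mu> (with_proj G) (\<lambda>_. 1) u v"

definition graph_power :: "'a pair_pre_digraph \<Rightarrow> nat \<Rightarrow> 'a pair_pre_digraph" where
  "graph_power G k =
     \<lparr>pverts = pverts G,
      parcs = {(u, v). u \<in> pverts G \<and> v \<in> pverts G \<and>
                       1 \<le> graph_dist G u v \<and> graph_dist G u v \<le> ereal (real k)}\<rparr>"

text \<open>
  \<^const>\<open>forest\<close> and \<^const>\<open>spanning_tree\<close> do not fit undirected graphs: there the closed walk
  \<open>u, v, u\<close> along a single edge counts as a \<^const>\<open>pre_digraph.cycle\<close>, so no symmetric digraph
  with an arc is a \<^const>\<open>forest\<close>. The cycles of an undirected simple graph are the directed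
  cycles of length at least 3.
\<close>

definition undirected_acyclic :: "'a pair_pre_digraph \<Rightarrow> bool" where
  "undirected_acyclic G \<longleftrightarrow> \<not> (\<exists>p. pre_digraph.cycle (with_proj G) p \<and> 3 \<le> length p)"

definition undirected_tree :: "'a pair_pre_digraph \<Rightarrow> bool" where
  "undirected_tree T \<longleftrightarrow>
     pair_graph T \<and> Digraph_Component.connected (with_proj T) \<and> undirected_acyclic T"

definition num_spanning_trees :: "'a pair_pre_digraph \<Rightarrow> nat" (\<open>\<tau>\<close>) where
  "\<tau> G = card {T. undirected_tree T \<and> spanning (with_proj T) (with_proj G)}"

end

theory Submission
  imports Defs
begin

text \<open>
  Let \<open>t\<^sub>n\<close> be the number of spanning trees of the square of the path on \<open>n\<close> vertices, and let
  \<open>s\<^sub>n\<close> be the number of its spanning forests that consist of exactly two trees, one containing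
  the last vertex and the other the last but one. The next vertex \<open>x\<close> of the path is adjacent to
  exactly the last two vertices \<open>a\<close> and \<open>b\<close>. In a spanning tree of the larger graph, \<open>x\<close> is
  either a leaf, attached to \<open>a\<close> or to \<open>b\<close>, and deleting it leaves a spanning tree; or it is
  adjacent to both, and deleting it leaves two trees that separate \<open>a\<close> from \<open>b\<close>. In a spanning
  forest of two trees that separate \<open>x\<close> from \<open>a\<close>, the edge between \<open>x\<close> and \<open>a\<close> is absent, so
  \<open>x\<close> is either isolated, and the rest is a spanning tree; or it is a leaf attached to \<open>b\<close>, and
  the rest is two trees that separate \<open>a\<close> from \<open>b\<close>. Hence
  \<open>t\<^bsub>n+1\<^esub> = 2 t\<^sub>n + s\<^sub>n\<close> and \<open>s\<^bsub>n+1\<^esub> = t\<^sub>n + s\<^sub>n\<close>, with both counts equal to \<open>1\<close> for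
  \<open>n = 2\<close>. Eliminating \<open>s\<close> gives \<open>t\<^bsub>n+2\<^esub> - 3 t\<^bsub>n+1\<^esub> + t\<^sub>n = 0\<close>, which is the denominator
  of the generating function; the values \<open>t\<^sub>4 = 8\<close> and \<open>t\<^sub>5 = 21\<close> give its numerator. The two
  counting steps are \<open>card_spanning_trees\<close> and \<open>card_spanning_two_trees\<close>.

  For these arguments a graph on a fixed vertex set is just a symmetric relation, and acyclicity is
  used in the form that every edge is a bridge, because that form is easy to follow when one edge
  is added (\<open>all_bridges_add_edge\<close>). Lemma \<open>undirected_acyclic_iff_all_bridges\<close> relates it to the
  absence of cycles, and \<open>num_spanning_trees_eq\<close> transfers the counts to \<^const>\<open>num_spanning_trees\<close>.
\<close>

section \<open>Acyclicity as a property of bridges\<close>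

definition edge :: "'a \<Rightarrow> 'a \<Rightarrow> 'a rel" where
  "edge a b = {(a, b), (b, a)}"

definition all_bridges :: "'a rel \<Rightarrow> bool" where
  "all_bridges E \<longleftrightarrow> (\<forall>(a, b) \<in> E. (a, b) \<notin> (E - edge a b)\<^sup>*)"

definition tree_on :: "'a set \<Rightarrow> 'a rel \<Rightarrow> bool" where
  "tree_on V E \<longleftrightarrow> sym E \<and> all_bridges E \<and> (\<forall>u\<in>V. \<forall>v\<in>V. (u, v) \<in> E\<^sup>*)"

definition two_trees_on :: "'a set \<Rightarrow> 'a \<Rightarrow> 'a \<Rightarrow> 'a rel \<Rightarrow> bool" where
  "two_trees_on V a b E \<longleftrightarrow> sym E \<and> all_bridges E \<and> (a, b) \<notin> E\<^sup>* \<and>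
     (\<forall>u\<in>V. (u, a) \<in> E\<^sup>* \<or> (u, b) \<in> E\<^sup>*)"

lemma edge_commute: "edge a b = edge b a"
  by (auto simp: edge_def)

lemma sym_edge: "sym (edge a b)"
  by (auto simp: edge_def sym_def)

lemma rtrancl_commute:
  assumes "sym E"
  shows "(u, v) \<in> E\<^sup>* \<longleftrightarrow> (v, u) \<in> E\<^sup>*"
  using sym_rtrancl[OF assms] by (auto dest: symD)

text \<open>
  A shortest walk uses the new edge at most once, so it is enough to distinguish whether the edge
  is avoided, or crossed in one of its two directions.
\<close>

lemma rtrancl_add_edge:
  "(u, v) \<in> (E \<union> edge a b)\<^sup>* \<longleftrightarrow>
     (u, v) \<in> E\<^sup>* \<or> (u, a) \<in> E\<^sup>* \<and> (b, v) \<in> E\<^sup>* \<or> (u, b) \<in> E\<^sup>* \<and> (a, v) \<in> E\<^sup>*"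
proof -
  have *: "E \<union> edge a b = insert (a, b) (insert (b, a) E)"
    by (auto simp: edge_def)
  show ?thesis
    unfolding * rtrancl_insert
    using rtrancl_trans[of u a E v] rtrancl_trans[of u b E v] by auto
qed

lemma rtrancl_isolated:
  assumes "F \<subseteq> V \<times> V" "x \<notin> V"
  shows "(x, v) \<in> F\<^sup>* \<longleftrightarrow> x = v" "(v, x) \<in> F\<^sup>* \<longleftrightarrow> v = x"
proof -
  have "x \<notin> Domain F" "x \<notin> Domain (F\<inverse>)" using assms by auto
  then show "(x, v) \<in> F\<^sup>* \<longleftrightarrow> x = v" "(v, x) \<in> F\<^sup>* \<longleftrightarrow> v = x"
    using Not_Domain_rtrancl[of x F v] Not_Domain_rtrancl[of x "F\<inverse>" v]
    by (auto simp: rtrancl_converse)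
qed

lemma all_bridgesD: "all_bridges E \<Longrightarrow> (a, b) \<in> E \<Longrightarrow> (a, b) \<notin> (E - edge a b)\<^sup>*"
  by (auto simp: all_bridges_def)

text \<open>
  A new edge closes a cycle exactly when its ends were already connected. If they were not, an old
  edge stays a bridge: a detour around it through the new edge would, together with the old edge
  itself, connect the ends of the new one.
\<close>

lemma all_bridges_add_edge:
  assumes "sym E" "(a, b) \<notin> E"
  shows "all_bridges (E \<union> edge a b) \<longleftrightarrow> all_bridges E \<and> (a, b) \<notin> E\<^sup>*"
proof
  have ba: "(b, a) \<notin> E" using assms by (auto dest: symD)
  then have rest: "E \<union> edge a b - edge a b = E"
    using assms(2) by (auto simp: edge_def)
  {
    assume bridges: "all_bridges (E \<union> edge a b)"
    have "(c, d) \<notin> (E - edge c d)\<^sup>*" if "(c, d) \<in> E" for c d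
    proof -
      have "(c, d) \<notin> (E \<union> edge a b - edge c d)\<^sup>*"
        using bridges that unfolding all_bridges_def by blast
      moreover have "(E - edge c d)\<^sup>* \<subseteq> (E \<union> edge a b - edge c d)\<^sup>*"
        by (intro rtrancl_mono) auto
      ultimately show ?thesis by blast
    qed
    moreover have "(a, b) \<notin> E\<^sup>*"
    proof -
      have "(a, b) \<in> E \<union> edge a b" by (simp add: edge_def)
      from all_bridgesD[OF bridges this] show ?thesis by (simp add: rest)
    qed
    ultimately show "all_bridges E \<and> (a, b) \<notin> E\<^sup>*"
      unfolding all_bridges_def by blast
  }
  {
    assume hyp: "all_bridges E \<and> (a, b) \<notin> E\<^sup>*"
    have "(c, d) \<notin> (E \<union> edge a b - edge c d)\<^sup>*" if cd: "(c, d) \<in> E \<union> edge a b" for c d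
    proof (cases "(c, d) \<in> E")
      case True
      let ?F = "E - edge c d"
      have eq: "E \<union> edge a b - edge c d = ?F \<union> edge a b"
        using True assms ba by (auto simp: edge_def dest: symD)
      have mono: "?F\<^sup>* \<subseteq> E\<^sup>*" by (intro rtrancl_mono) auto
      have nF: "(c, d) \<notin> ?F\<^sup>*" using hyp True unfolding all_bridges_def by blast
      have dc: "(c, d) \<in> E\<^sup>*" "(d, c) \<in> E\<^sup>*" using True assms(1) by (auto dest: symD)
      show ?thesis
      proof
        assume "(c, d) \<in> (E \<union> edge a b - edge c d)\<^sup>*"
        then have "(c, a) \<in> ?F\<^sup>* \<and> (b, d) \<in> ?F\<^sup>* \<or> (c, b) \<in> ?F\<^sup>* \<and> (a, d) \<in> ?F\<^sup>*"
          unfolding eq rtrancl_add_edge using nF by blast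
        then have "(c, a) \<in> E\<^sup>* \<and> (b, d) \<in> E\<^sup>* \<or> (c, b) \<in> E\<^sup>* \<and> (a, d) \<in> E\<^sup>*"
          using mono by blast
        then have "(a, b) \<in> E\<^sup>*"
          using dc rtrancl_commute[OF assms(1)] by (meson rtrancl_trans)
        then show False using hyp by blast
      qed
    next
      case False
      then have "(c, d) = (a, b) \<or> (c, d) = (b, a)" using cd by (auto simp: edge_def)
      then show ?thesis
        using hyp rest rtrancl_commute[OF assms(1)] edge_commute[of a b] by auto
    qed
    then show "all_bridges (E \<union> edge a b)" unfolding all_bridges_def by blast
  }
qed

section \<open>Attaching a vertex to a tree or to a two-component forest\<close>

context
  fixes V :: "'a set" and x a b :: 'a and F :: "'a rel"
  assumes F: "F \<subseteq> V \<times> V" "sym F" and x: "x \<notin> V" and ab: "a \<in> V" "b \<in> V"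
begin

lemma tree_on_add_leaf: "tree_on (insert x V) (F \<union> edge x a) \<longleftrightarrow> tree_on V F"
proof -
  note iso = rtrancl_isolated[OF F(1) x]
  have "(x, a) \<notin> F" using F x by auto
  then have br: "all_bridges (F \<union> edge x a) \<longleftrightarrow> all_bridges F"
    using all_bridges_add_edge[of F x a] F(2) iso x ab by auto
  have "(\<forall>u\<in>insert x V. \<forall>v\<in>insert x V. (u, v) \<in> (F \<union> edge x a)\<^sup>*) \<longleftrightarrow>
        (\<forall>u\<in>V. \<forall>v\<in>V. (u, v) \<in> F\<^sup>*)"
    unfolding rtrancl_add_edge using x ab iso by auto
  then show ?thesis
    unfolding tree_on_def br using F(2) sym_Un[OF F(2) sym_edge] by auto
qed

text \<open>
  A vertex without edges is a component of its own, so the other component is everything else.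
\<close>

lemma two_trees_on_isolated: "two_trees_on (insert x V) x a F \<longleftrightarrow> tree_on V F"
proof -
  note iso = rtrancl_isolated[OF F(1) x]
  have "(\<forall>u\<in>V. \<forall>v\<in>V. (u, v) \<in> F\<^sup>*) \<longleftrightarrow> (\<forall>u\<in>V. (u, a) \<in> F\<^sup>*)"
    using ab rtrancl_commute[OF F(2)] by (meson rtrancl_trans)
  then show ?thesis
    unfolding two_trees_on_def tree_on_def using x ab iso by auto
qed

text \<open>A leaf lies in the same component as its neighbour, so \<open>x\<close> takes over the role of \<open>b\<close>.\<close>

lemma two_trees_on_add_leaf:
  "two_trees_on (insert x V) x a (F \<union> edge x b) \<longleftrightarrow> two_trees_on V a b F"
proof -
  note iso = rtrancl_isolated[OF F(1) x]
  have "(x, b) \<notin> F" using F x by auto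
  then have br: "all_bridges (F \<union> edge x b) \<longleftrightarrow> all_bridges F"
    using all_bridges_add_edge[of F x b] F(2) iso x ab by auto
  have sep: "(x, a) \<in> (F \<union> edge x b)\<^sup>* \<longleftrightarrow> (a, b) \<in> F\<^sup>*"
    unfolding rtrancl_add_edge using x ab iso rtrancl_commute[OF F(2)] by auto
  have "(\<forall>u\<in>insert x V. (u, x) \<in> (F \<union> edge x b)\<^sup>* \<or> (u, a) \<in> (F \<union> edge x b)\<^sup>*) \<longleftrightarrow>
        (\<forall>u\<in>V. (u, a) \<in> F\<^sup>* \<or> (u, b) \<in> F\<^sup>*)"
    unfolding rtrancl_add_edge using x ab iso by auto
  then show ?thesis
    unfolding two_trees_on_def br sep using F(2) sym_Un[OF F(2) sym_edge] by auto
qed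

text \<open>
  The path from \<open>a\<close> over \<open>x\<close> to \<open>b\<close> acts like one edge between \<open>a\<close> and \<open>b\<close>: it must join two
  different components, and these must be the only ones.
\<close>

lemma tree_on_add_path:
  assumes "a \<noteq> b"
  shows "tree_on (insert x V) (F \<union> edge x a \<union> edge x b) \<longleftrightarrow> two_trees_on V a b F"
proof -
  note iso = rtrancl_isolated[OF F(1) x]
  let ?E = "F \<union> edge x a"
  have sE: "sym ?E" using F(2) sym_edge by (rule sym_Un)
  have "(x, a) \<notin> F" using F x by auto
  then have br: "all_bridges ?E \<longleftrightarrow> all_bridges F"
    using all_bridges_add_edge[of F x a] F(2) iso x ab by auto
  have "(x, b) \<notin> ?E" using F x ab assms by (auto simp: edge_def)
  then have br2: "all_bridges (?E \<union> edge x b) \<longleftrightarrow> all_bridges F \<and> (x, b) \<notin> ?E\<^sup>*"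
    using all_bridges_add_edge[of ?E x b] sE br by auto
  have sep: "(x, b) \<in> ?E\<^sup>* \<longleftrightarrow> (a, b) \<in> F\<^sup>*"
    unfolding rtrancl_add_edge using x ab iso by auto
  have "(\<forall>u\<in>insert x V. \<forall>v\<in>insert x V. (u, v) \<in> (?E \<union> edge x b)\<^sup>*) \<longleftrightarrow>
        (\<forall>u\<in>insert x V. (u, x) \<in> (?E \<union> edge x b)\<^sup>*)"
    using rtrancl_commute[OF sym_Un[OF sE sym_edge[of x b]]]
    by (meson insertI1 rtrancl_trans)
  also have "\<dots> \<longleftrightarrow> (\<forall>u\<in>V. (u, a) \<in> F\<^sup>* \<or> (u, b) \<in> F\<^sup>*)"
    unfolding rtrancl_add_edge using x ab iso by auto
  finally show ?thesis
    unfolding two_trees_on_def tree_on_def br2 sep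
    using F(2) sE sym_Un[OF sE sym_edge] by auto
qed

lemma not_tree_on_isolated: "\<not> tree_on (insert x V) F"
  unfolding tree_on_def using rtrancl_isolated[OF F(1) x] x ab by auto

end

section \<open>Counting after attaching a triangle\<close>

definition spanning_trees :: "'a set \<Rightarrow> 'a rel \<Rightarrow> 'a rel set" where
  "spanning_trees V S = {E. E \<subseteq> S \<and> tree_on V E}"

definition spanning_two_trees :: "'a set \<Rightarrow> 'a rel \<Rightarrow> 'a \<Rightarrow> 'a \<Rightarrow> 'a rel set" where
  "spanning_two_trees V S a b = {E. E \<subseteq> S \<and> two_trees_on V a b E}"

text \<open>
  The name refers to the square of a path: there \<open>a\<close> and \<open>b\<close> are adjacent, and \<open>x\<close> completes a
  triangle.
\<close>

locale attach_triangle =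
  fixes V :: "'a set" and S :: "'a rel" and x a b :: 'a
  assumes finite_V: "finite V" and S: "S \<subseteq> V \<times> V" and x: "x \<notin> V"
    and a: "a \<in> V" and b: "b \<in> V" and ab: "a \<noteq> b"
begin

abbreviation S' :: "'a rel" where "S' \<equiv> S \<union> edge x a \<union> edge x b"

lemma spanning_subset: "spanning_trees V S \<subseteq> Pow S" "spanning_two_trees V S a b \<subseteq> Pow S"
  by (auto simp: spanning_trees_def spanning_two_trees_def)

lemma finite_spanning: "finite (spanning_trees V S)" "finite (spanning_two_trees V S a b)"
proof -
  have "finite (Pow S)" using finite_subset[OF S] finite_V by simp
  then show "finite (spanning_trees V S)" "finite (spanning_two_trees V S a b)"
    using finite_subset[OF spanning_subset(1)] finite_subset[OF spanning_subset(2)] by blast+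
qed

text \<open>
  Symmetry makes both arcs of a new edge occur together, so that a subgraph is determined by its
  old part and by the set of new neighbours of \<open>x\<close>.
\<close>

lemma sym_subset_cases:
  assumes "sym E" "E \<subseteq> S'"
  obtains F where "F \<subseteq> S" "sym F"
    "E = F \<or> E = F \<union> edge x a \<or> E = F \<union> edge x b \<or> E = F \<union> edge x a \<union> edge x b"
proof
  let ?F = "E \<inter> V \<times> V"
  show "?F \<subseteq> S" using assms(2) x by (auto simp: edge_def)
  show "sym ?F" using assms(1) by (auto simp: sym_def)
  have "(x, c) \<in> E \<longleftrightarrow> (c, x) \<in> E" for c using assms(1) by (auto dest: symD)
  then have *: "edge x c \<subseteq> E \<or> edge x c \<inter> E = {}" for c by (auto simp: edge_def)
  have E: "E = ?F \<union> (E \<inter> edge x a) \<union> (E \<inter> edge x b)" using assms(2) S by blast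
  then show "E = ?F \<or> E = ?F \<union> edge x a \<or> E = ?F \<union> edge x b \<or> E = ?F \<union> edge x a \<union> edge x b"
    using *[of a] *[of b] E by (metis (no_types) inf.absorb2 inf_commute sup_bot.right_neutral)
qed

lemma card_image_union:
  assumes "A \<subseteq> Pow S" "D \<inter> V \<times> V = {}"
  shows "card ((\<lambda>F. F \<union> D) ` A) = card A"
proof (rule card_image, rule inj_onI)
  fix F G assume "F \<in> A" "G \<in> A" "F \<union> D = G \<union> D"
  then show "F = G" using assms S by blast
qed

lemma disjoint_image_union:
  assumes "A \<subseteq> Pow S" "B \<subseteq> Pow S" "e \<in> D" "e \<notin> D'" "e \<notin> V \<times> V"
  shows "(\<lambda>F. F \<union> D) ` A \<inter> (\<lambda>F. F \<union> D') ` B = {}"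
proof -
  have "F \<union> D \<noteq> G \<union> D'" if "G \<in> B" for F G
  proof -
    have "e \<notin> G" using assms(2,5) S that by auto
    then show ?thesis using assms(3,4) by auto
  qed
  then show ?thesis by auto
qed

lemma new_edges: "edge x a \<inter> V \<times> V = {}" "edge x b \<inter> V \<times> V = {}"
    "(edge x a \<union> edge x b) \<inter> V \<times> V = {}"
  using x by (auto simp: edge_def)

lemma new_arcs_distinct:
  "(x, a) \<in> edge x a" "(x, b) \<in> edge x b" "(x, a) \<notin> edge x b" "(x, b) \<notin> edge x a"
  using ab a b x by (auto simp: edge_def)

text \<open>
  The three parts are the trees in which \<open>x\<close> is adjacent to \<open>a\<close> only, to \<open>b\<close> only, or to both.
\<close>

lemma card_spanning_trees:
  "card (spanning_trees (insert x V) S') =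
     2 * card (spanning_trees V S) + card (spanning_two_trees V S a b)"
proof -
  let ?T = "spanning_trees V S" and ?U = "spanning_two_trees V S a b"
  let ?A = "(\<lambda>F. F \<union> edge x a) ` ?T" and ?B = "(\<lambda>F. F \<union> edge x b) ` ?T"
    and ?C = "(\<lambda>F. F \<union> (edge x a \<union> edge x b)) ` ?U"
  have eq: "spanning_trees (insert x V) S' = ?A \<union> ?B \<union> ?C"
  proof
    show "spanning_trees (insert x V) S' \<subseteq> ?A \<union> ?B \<union> ?C"
    proof
      fix E assume "E \<in> spanning_trees (insert x V) S'"
      then have E: "E \<subseteq> S'" "sym E" "tree_on (insert x V) E"
        by (auto simp: spanning_trees_def tree_on_def)
      then obtain F where F: "F \<subseteq> S" "sym F"
        and cases: "E = F \<or> E = F \<union> edge x a \<or> E = F \<union> edge x b \<or> E = F \<union> edge x a \<union> edge x b"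
        by (auto elim: sym_subset_cases)
      have FV: "F \<subseteq> V \<times> V" using F S by auto
      from cases consider "E = F" | "E = F \<union> edge x a" | "E = F \<union> edge x b"
        | "E = F \<union> edge x a \<union> edge x b" by blast
      then show "E \<in> ?A \<union> ?B \<union> ?C"
      proof cases
        case 1
        then show ?thesis using E not_tree_on_isolated[OF FV F(2) x a b] by auto
      next
        case 2
        then have "F \<in> ?T"
          using E F tree_on_add_leaf[OF FV F(2) x a b] by (auto simp: spanning_trees_def)
        then show ?thesis using 2 by blast
      next
        case 3
        then have "F \<in> ?T"
          using E F tree_on_add_leaf[OF FV F(2) x b a] by (auto simp: spanning_trees_def)
        then show ?thesis using 3 by blast
      next
        case 4
        then have "F \<in> ?U"
          using E F tree_on_add_path[OF FV F(2) x a b ab] by (auto simp: spanning_two_trees_def)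
        then show ?thesis using 4 by (auto simp: Un_assoc)
      qed
    qed
    have T: "F \<subseteq> V \<times> V" "sym F" if "F \<in> ?T" for F
      using that S by (auto simp: spanning_trees_def tree_on_def)
    have A: "?A \<subseteq> spanning_trees (insert x V) S'"
      using T tree_on_add_leaf[OF _ _ x a b] by (auto simp: spanning_trees_def)
    have B: "?B \<subseteq> spanning_trees (insert x V) S'"
      using T tree_on_add_leaf[OF _ _ x b a] by (auto simp: spanning_trees_def)
    have U: "F \<subseteq> V \<times> V" "sym F" if "F \<in> ?U" for F
      using that S by (auto simp: spanning_two_trees_def two_trees_on_def)
    have C: "?C \<subseteq> spanning_trees (insert x V) S'"
      using U tree_on_add_path[OF _ _ x a b ab]
      by (auto simp: spanning_trees_def spanning_two_trees_def Un_assoc)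
    show "?A \<union> ?B \<union> ?C \<subseteq> spanning_trees (insert x V) S'"
      by (intro Un_least A B C)
  qed
  have "?A \<inter> ?B = {}" "?C \<inter> ?A = {}" "?C \<inter> ?B = {}"
    using disjoint_image_union[OF spanning_subset(1,1), of "(x, a)" "edge x a" "edge x b"]
      disjoint_image_union[OF spanning_subset(2,1), of "(x, b)" "edge x a \<union> edge x b" "edge x a"]
      disjoint_image_union[OF spanning_subset(2,1), of "(x, a)" "edge x a \<union> edge x b" "edge x b"]
      new_arcs_distinct x by simp_all
  then have disj: "?A \<inter> ?B = {}" "(?A \<union> ?B) \<inter> ?C = {}"
    by (simp_all only: Int_Un_distrib Int_commute[of _ ?C] Un_empty)
  have card: "card ?A = card ?T" "card ?B = card ?T" "card ?C = card ?U"
    using card_image_union[OF spanning_subset(1)] card_image_union[OF spanning_subset(2)]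
      new_edges by simp_all
  have "card (?A \<union> ?B \<union> ?C) = card ?A + card ?B + card ?C"
    using disj finite_spanning by (simp add: card_Un_disjoint)
  then show ?thesis unfolding eq by (simp add: card)
qed

text \<open>
  The forests counted on the left separate \<open>x\<close> from \<open>a\<close>, not \<open>a\<close> from \<open>b\<close>: in the square of a
  path, \<open>x\<close> and \<open>a\<close> are the two vertices to which the next vertex is attached. The two parts are
  the forests in which \<open>x\<close> is isolated, and those in which it is adjacent to \<open>b\<close> only.
\<close>

lemma card_spanning_two_trees:
  "card (spanning_two_trees (insert x V) S' x a) =
     card (spanning_trees V S) + card (spanning_two_trees V S a b)"
proof -
  let ?T = "spanning_trees V S" and ?U = "spanning_two_trees V S a b"
  let ?B = "(\<lambda>F. F \<union> edge x b) ` ?U"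
  have "spanning_two_trees (insert x V) S' x a = ?T \<union> ?B"
  proof
    show "spanning_two_trees (insert x V) S' x a \<subseteq> ?T \<union> ?B"
    proof
      fix E assume "E \<in> spanning_two_trees (insert x V) S' x a"
      then have E: "E \<subseteq> S'" "sym E" "two_trees_on (insert x V) x a E"
        by (auto simp: spanning_two_trees_def two_trees_on_def)
      then have "(x, a) \<notin> E" by (simp add: two_trees_on_def) blast
      obtain F where F: "F \<subseteq> S" "sym F"
        and "E = F \<or> E = F \<union> edge x a \<or> E = F \<union> edge x b \<or> E = F \<union> edge x a \<union> edge x b"
        by (rule sym_subset_cases[OF E(2,1)])
      then have cases: "E = F \<or> E = F \<union> edge x b"
        using \<open>(x, a) \<notin> E\<close> new_arcs_distinct(1) by auto
      have FV: "F \<subseteq> V \<times> V" using F S by auto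
      from cases show "E \<in> ?T \<union> ?B"
      proof
        assume "E = F"
        then show ?thesis
          using E F two_trees_on_isolated[OF FV F(2) x a b] by (auto simp: spanning_trees_def)
      next
        assume 2: "E = F \<union> edge x b"
        then have "F \<in> ?U"
          using E F two_trees_on_add_leaf[OF FV F(2) x a b]
          by (auto simp: spanning_two_trees_def)
        then show ?thesis using 2 by blast
      qed
    qed
    have T: "F \<subseteq> V \<times> V" "sym F" if "F \<in> ?T" for F
      using that S by (auto simp: spanning_trees_def tree_on_def)
    have A: "?T \<subseteq> spanning_two_trees (insert x V) S' x a"
      using T two_trees_on_isolated[OF _ _ x a b]
      by (auto simp: spanning_trees_def spanning_two_trees_def)
    have U: "F \<subseteq> V \<times> V" "sym F" if "F \<in> ?U" for F
      using that S by (auto simp: spanning_two_trees_def two_trees_on_def)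
    have B: "?B \<subseteq> spanning_two_trees (insert x V) S' x a"
      using U two_trees_on_add_leaf[OF _ _ x a b] by (auto simp: spanning_two_trees_def)
    show "?T \<union> ?B \<subseteq> spanning_two_trees (insert x V) S' x a"
      by (intro Un_least A B)
  qed
  moreover have "card (?T \<union> ?B) = card ?T + card ?B"
  proof (rule card_Un_disjoint)
    show "finite ?T" "finite ?B" using finite_spanning by simp_all
    show "?T \<inter> ?B = {}"
      using disjoint_image_union[OF spanning_subset(2,1), of "(x, b)" "edge x b" "{}"]
        new_arcs_distinct x by (simp add: Int_commute)
  qed
  moreover have "card ?B = card ?U"
    using card_image_union[OF spanning_subset(2)] new_edges by simp
  ultimately show ?thesis by simp
qed

end

section \<open>The recurrence for the square of a path\<close>

definition path_square :: "nat \<Rightarrow> nat rel" where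
  "path_square n = {(i, j). i < n \<and> j < n \<and> (j = i + 1 \<or> i = j + 1 \<or> j = i + 2 \<or> i = j + 2)}"

lemma path_square_Suc:
  "path_square (Suc (Suc (Suc m))) =
     path_square (Suc (Suc m)) \<union> edge (Suc (Suc m)) (Suc m) \<union> edge (Suc (Suc m)) m"
  by (auto simp: path_square_def edge_def)

text \<open>
  The index \<open>m\<close> belongs to the path on \<open>m + 2\<close> vertices, the last two of which are \<open>m + 1\<close> and
  \<open>m\<close>; the path needs two vertices for the second count to make sense.
\<close>

definition num_trees :: "nat \<Rightarrow> nat" where
  "num_trees m = card (spanning_trees {..<Suc (Suc m)} (path_square (Suc (Suc m))))"

definition num_two_trees :: "nat \<Rightarrow> nat" where
  "num_two_trees m =
     card (spanning_two_trees {..<Suc (Suc m)} (path_square (Suc (Suc m))) (Suc m) m)"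

lemma num_trees_Suc:
    "num_trees (Suc m) = 2 * num_trees m + num_two_trees m"
  and num_two_trees_Suc:
    "num_two_trees (Suc m) = num_trees m + num_two_trees m"
proof -
  interpret attach_triangle "{..<Suc (Suc m)}" "path_square (Suc (Suc m))" "Suc (Suc m)" "Suc m" m
    by unfold_locales (auto simp: path_square_def)
  show "num_trees (Suc m) = 2 * num_trees m + num_two_trees m"
       "num_two_trees (Suc m) = num_trees m + num_two_trees m"
    using card_spanning_trees card_spanning_two_trees
    unfolding num_trees_def num_two_trees_def path_square_Suc lessThan_Suc by simp_all
qed

lemma num_trees_0: "num_trees 0 = 1" and num_two_trees_0: "num_two_trees 0 = 1"
proof -
  have V: "{..<Suc (Suc 0)} = {0, 1}" by auto
  have S: "path_square (Suc (Suc 0)) = edge 0 1"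
    by (auto simp: path_square_def edge_def)
  have sub: "E = {} \<or> E = edge 0 1" if "sym E" "E \<subseteq> edge 0 1" for E :: "nat rel"
    using that by (auto simp: edge_def dest: symD)
  have br: "all_bridges ({} :: nat rel)" "all_bridges (edge 0 1 :: nat rel)"
    by (auto simp: all_bridges_def edge_def)
  have sep: "(0, 1) \<notin> ({} :: nat rel)\<^sup>*" by auto
  have con: "(0, 1) \<in> (edge 0 1 :: nat rel)\<^sup>*" "(1, 0) \<in> (edge 0 1 :: nat rel)\<^sup>*"
    by (auto simp: edge_def)
  have "E \<in> spanning_trees {0, 1} (edge 0 1) \<longleftrightarrow> E = edge 0 1" for E :: "nat rel"
  proof
    assume "E \<in> spanning_trees {0, 1} (edge 0 1)"
    then have "sym E" "E \<subseteq> edge 0 1" "(0, 1) \<in> E\<^sup>*"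
      by (auto simp: spanning_trees_def tree_on_def)
    then show "E = edge 0 1" using sub sep by blast
  next
    assume "E = edge 0 1"
    then show "E \<in> spanning_trees {0, 1} (edge 0 1)"
      using br con sym_edge by (auto simp: spanning_trees_def tree_on_def)
  qed
  then have "spanning_trees {0, 1} (edge 0 1) = {edge 0 (1 :: nat)}" by auto
  then show "num_trees 0 = 1" by (simp add: num_trees_def V S)
  have "E \<in> spanning_two_trees {0, 1} (edge 0 1) 1 0 \<longleftrightarrow> E = {}" for E :: "nat rel"
  proof
    assume "E \<in> spanning_two_trees {0, 1} (edge 0 1) 1 0"
    then have "sym E" "E \<subseteq> edge 0 1" "(1, 0) \<notin> E\<^sup>*"
      by (auto simp: spanning_two_trees_def two_trees_on_def)
    then show "E = {}" using sub con by blast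
  next
    assume "E = {}"
    then show "E \<in> spanning_two_trees {0, 1} (edge 0 1) 1 0"
      using br by (auto simp: spanning_two_trees_def two_trees_on_def sym_def)
  qed
  then have "spanning_two_trees {0, 1} (edge 0 1) 1 0 = {{} :: nat rel}" by auto
  then show "num_two_trees 0 = 1" by (simp add: num_two_trees_def V S)
qed

lemma num_trees_recurrence:
  "num_trees (Suc (Suc m)) + num_trees m = 3 * num_trees (Suc m)"
  by (simp add: num_trees_Suc num_two_trees_Suc)

section \<open>Spanning trees as edge sets\<close>

text \<open>
  If an edge is not a bridge, a path between its ends that avoids it has length at least 2, because
  the graph is simple, and closes up to a cycle of length at least 3. Conversely, in such a cycle no
  later arc runs along the first edge, in either direction: the cycle visits both ends of that edge
  only once, and a closed walk that goes back and forth along a single edge is excluded by the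
  length. So the rest of the cycle connects the ends of the first edge without using it.
\<close>

lemma undirected_acyclic_iff_all_bridges:
  assumes "pair_graph G"
  shows "undirected_acyclic G \<longleftrightarrow> all_bridges (parcs G)"
proof -
  interpret G: pair_graph G by fact
  have symG: "sym (parcs G)" using G.arcs_symmetric by (auto intro: symI)
  show ?thesis
  proof
    assume acyc: "undirected_acyclic G"
    have "(a, b) \<notin> (parcs G - edge a b)\<^sup>*" if ab: "(a, b) \<in> parcs G" for a b
    proof
      assume "(a, b) \<in> (parcs G - edge a b)\<^sup>*"
      define H where "H = \<lparr>pverts = pverts G, parcs = parcs G - edge a b\<rparr>"
      interpret H: pair_wf_digraph H
        by unfold_locales (auto simp: H_def dest: G.in_arcsD1 G.in_arcsD2)
      have "sym (parcs G - edge a b)"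
        using symG by (auto simp: sym_def edge_def)
      then have "(b, a) \<in> (parcs G - edge a b)\<^sup>*"
        using \<open>(a, b) \<in> (parcs G - edge a b)\<^sup>*\<close> rtrancl_commute by metis
      then have "b \<rightarrow>\<^sup>*\<^bsub>with_proj H\<^esub> a"
        using G.in_arcsD2[OF ab] by (subst H.reachable_conv') (auto simp: H_def)
      then obtain q where q: "H.apath b q a" using H.reachable_apath by blast
      have "a \<noteq> b" using G.no_loops'[OF ab] .
      then obtain f r where fr: "q = f # r"
        using q by (cases q) (auto simp: H.apath_Nil_iff)
      have "r \<noteq> []"
      proof
        assume "r = []"
        then have "f \<in> parcs H" "f = (b, a)"
          using q fr by (auto simp: H.apath_simps prod_eq_iff)
        then show False by (simp add: H_def edge_def)
      qed
      then have len: "3 \<le> length ((a, b) # q)"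
        using fr by (cases r) auto
      have "set q \<subseteq> parcs H" "pcas b q a" "distinct (pawalk_verts b q)"
        using q by (auto simp: H.apath_def H.awalk_def)
      moreover have "parcs H \<subseteq> parcs G" by (auto simp: H_def)
      ultimately have "G.cycle ((a, b) # q)"
        unfolding G.cycle_def G.awalk_def
        using ab G.in_arcsD1[OF ab] by (intro exI[of _ a]) auto
      then show False using acyc len unfolding undirected_acyclic_def by blast
    qed
    then show "all_bridges (parcs G)" unfolding all_bridges_def by blast
  next
    assume bridges: "all_bridges (parcs G)"
    show "undirected_acyclic G"
      unfolding undirected_acyclic_def
    proof (safe)
      fix p assume "G.cycle p" "3 \<le> length p"
      then obtain u e f r where p: "p = e # f # r" "r \<noteq> []"
        and walk: "G.awalk u p u" "distinct (tl (pawalk_verts u p))"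
        unfolding G.cycle_def by (cases p; cases "tl p") force+
      define w where "w = snd e"
      have e: "e = (u, w)" "e \<in> parcs G"
        using walk(1) p by (auto simp: G.awalk_Cons_iff w_def prod_eq_iff)
      have "G.apath w (f # r) u"
        using walk p by (auto simp: G.apath_def G.awalk_Cons_iff w_def)
      then have f: "f \<in> parcs G" "fst f = w" and r: "G.apath (snd f) r u"
        and wr: "w \<notin> set (pawalk_verts (snd f) r)"
        by (auto simp: G.apath_Cons_iff)
      have "snd f \<noteq> u" using G.apath_nonempty_ends[OF r p(2)] .
      moreover have "u \<noteq> w" using e G.no_loops' by auto
      ultimately have "f \<notin> edge u w" using f by (auto simp: edge_def prod_eq_iff)
      then have fE: "(w, snd f) \<in> parcs G - edge u w" using f by (metis DiffI prod.collapse)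
      have walk_r: "G.awalk (snd f) r u" using r by (simp add: G.apath_def)
      have "g \<notin> edge u w" if "g \<in> set r" for g
      proof -
        have "fst g \<in> set (pawalk_verts (snd f) r)" "snd g \<in> set (pawalk_verts (snd f) r)"
          using G.awalk_verts_arc1[OF that] G.awalk_verts_arc2[OF walk_r that] by auto
        then show ?thesis using wr by (auto simp: edge_def prod_eq_iff)
      qed
      then have rE: "set r \<subseteq> parcs G - edge u w" using walk_r by (auto simp: G.awalk_def)
      have "(s, t) \<in> (parcs G - edge u w)\<^sup>*" if "pcas s q t" "set q \<subseteq> parcs G - edge u w" for s q t
        using that
        by (induction s q t rule: pcas.induct) (auto intro: converse_rtrancl_into_rtrancl)
      then have "(snd f, u) \<in> (parcs G - edge u w)\<^sup>*"
        using rE walk_r by (auto simp: G.awalk_def)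
      then have "(w, u) \<in> (parcs G - edge u w)\<^sup>*"
        using fE by (rule converse_rtrancl_into_rtrancl[rotated])
      moreover have "(w, u) \<in> parcs G" using e symG by (auto dest: symD)
      ultimately show False
        using all_bridgesD[OF bridges] edge_commute[of u w] by metis
    qed
  qed
qed

lemma connected_iff_rtrancl:
  assumes "pair_graph G"
  shows "Digraph_Component.connected (with_proj G) \<longleftrightarrow>
    pverts G \<noteq> {} \<and> (\<forall>u\<in>pverts G. \<forall>v\<in>pverts G. (u, v) \<in> (parcs G)\<^sup>*)"
proof -
  interpret G: pair_graph G by fact
  have "mk_symmetric (with_proj G) = G"
    by (rule pair_pre_digraph.equality)
       (auto simp: mk_symmetric_def dest: G.arcs_symmetric)
  then show ?thesis
    by (auto simp: Digraph_Component.connected_def strongly_connected_def G.reachable_conv)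
qed

lemma num_spanning_trees_eq:
  assumes "pair_graph G" "pverts G \<noteq> {}"
  shows "\<tau> G = card (spanning_trees (pverts G) (parcs G))"
proof -
  interpret G: pair_graph G by fact
  let ?A = "{T. undirected_tree T \<and> spanning (with_proj T) (with_proj G)}"
  have "bij_betw parcs ?A (spanning_trees (pverts G) (parcs G))"
  proof (rule bij_betw_byWitness[where f' = "\<lambda>E. \<lparr>pverts = pverts G, parcs = E\<rparr>"])
    show "\<forall>T\<in>?A. \<lparr>pverts = pverts G, parcs = parcs T\<rparr> = T"
      by (auto simp: spanning_def)
    show "\<forall>E\<in>spanning_trees (pverts G) (parcs G). parcs \<lparr>pverts = pverts G, parcs = E\<rparr> = E"
      by simp
    show "parcs ` ?A \<subseteq> spanning_trees (pverts G) (parcs G)"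
    proof safe
      fix T assume T: "undirected_tree T" "spanning (with_proj T) (with_proj G)"
      then interpret T: pair_graph T by (simp add: undirected_tree_def)
      have "sym (parcs T)" using T.arcs_symmetric by (auto intro: symI)
      then show "parcs T \<in> spanning_trees (pverts G) (parcs G)"
        using T undirected_acyclic_iff_all_bridges[OF T.pair_graph]
          connected_iff_rtrancl[OF T.pair_graph]
        by (auto simp: spanning_trees_def tree_on_def undirected_tree_def spanning_def
              subgraph_def)
    qed
    show "(\<lambda>E. \<lparr>pverts = pverts G, parcs = E\<rparr>) ` spanning_trees (pverts G) (parcs G) \<subseteq> ?A"
    proof safe
      fix E assume "E \<in> spanning_trees (pverts G) (parcs G)"
      then have E: "E \<subseteq> parcs G" "sym E" "all_bridges E"
        "\<forall>u\<in>pverts G. \<forall>v\<in>pverts G. (u, v) \<in> E\<^sup>*"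
        by (auto simp: spanning_trees_def tree_on_def)
      let ?T = "\<lparr>pverts = pverts G, parcs = E\<rparr>"
      have T: "pair_graph ?T"
        using E G.in_arcsD1 G.in_arcsD2 G.no_loops' G.pair_finite_verts
          finite_subset[OF E(1) G.pair_finite_arcs]
        by unfold_locales (auto simp: symmetric_def)
      then show "undirected_tree ?T"
        using E assms(2) undirected_acyclic_iff_all_bridges[OF T] connected_iff_rtrancl[OF T]
        by (auto simp: undirected_tree_def)
      interpret T: pair_graph ?T by fact
      show "spanning (with_proj ?T) (with_proj G)"
        using E G.wf_digraph T.wf_digraph by (auto simp: spanning_def subgraph_def)
    qed
  qed
  then show ?thesis
    unfolding num_spanning_trees_def by (rule bij_betw_same_card)
qed

section \<open>The square of a graph\<close>

text \<open>
  The distance is an infimum of lengths of walks, and natural numbers attain their infimum: if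
  every walk is longer than \<open>k\<close>, the infimum is at least \<open>k + 1\<close>, possibly infinite.
\<close>

lemma graph_dist_le_iff:
  assumes "pair_wf_digraph G"
  shows "graph_dist G u v \<le> ereal (real k) \<longleftrightarrow>
    (\<exists>p. pre_digraph.awalk (with_proj G) u p v \<and> length p \<le> k)"
proof -
  interpret G: pair_wf_digraph G by fact
  have cost: "G.awalk_cost (\<lambda>_. 1) p = real (length p)" for p
    by (simp add: G.awalk_cost_def sum_list_triv)
  show ?thesis
  proof
    assume le: "graph_dist G u v \<le> ereal (real k)"
    show "\<exists>p. G.awalk u p v \<and> length p \<le> k"
    proof (rule ccontr)
      assume "\<not> ?thesis"
      then have "ereal (real (Suc k)) \<le> graph_dist G u v"
        unfolding graph_dist_def G.\<mu>_def by (intro INF_greatest) (auto simp: cost not_le)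
      then have "ereal (real (Suc k)) \<le> ereal (real k)" using le by (rule order_trans)
      then show False by simp
    qed
  next
    assume "\<exists>p. G.awalk u p v \<and> length p \<le> k"
    then obtain p where p: "G.awalk u p v" "length p \<le> k" by blast
    have "graph_dist G u v \<le> ereal (real (length p))"
      using G.min_cost_le_walk_cost[OF p(1), of "\<lambda>_. 1"] by (simp add: graph_dist_def cost)
    also have "\<dots> \<le> ereal (real k)" using p(2) by simp
    finally show "graph_dist G u v \<le> ereal (real k)" .
  qed
qed

lemma one_le_graph_dist_iff:
  assumes "pair_wf_digraph G" "u \<in> pverts G"
  shows "1 \<le> graph_dist G u v \<longleftrightarrow> u \<noteq> v"
proof -
  interpret G: pair_wf_digraph G by fact
  have cost: "G.awalk_cost (\<lambda>_. 1) p = real (length p)" for p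
    by (simp add: G.awalk_cost_def sum_list_triv)
  have "1 \<le> graph_dist G u v \<longleftrightarrow> (\<forall>p. G.awalk u p v \<longrightarrow> 1 \<le> length p)"
    unfolding graph_dist_def G.\<mu>_def le_INF_iff by (auto simp: cost one_ereal_def)
  also have "\<dots> \<longleftrightarrow> \<not> G.awalk u [] v"
    by (auto simp: Suc_le_eq)
  finally show ?thesis using assms(2) by (simp add: G.awalk_Nil_iff)
qed

lemma graph_power_2:
  assumes "pair_wf_digraph G"
  shows "(u, v) \<in> parcs (graph_power G 2) \<longleftrightarrow>
    u \<noteq> v \<and> ((u, v) \<in> parcs G \<or> (\<exists>w. (u, w) \<in> parcs G \<and> (w, v) \<in> parcs G))"
proof -
  interpret G: pair_wf_digraph G by fact
  have "(\<exists>p. G.awalk u p v \<and> length p \<le> 2) \<longleftrightarrow>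
    u = v \<and> u \<in> pverts G \<or> (u, v) \<in> parcs G \<or> (\<exists>w. (u, w) \<in> parcs G \<and> (w, v) \<in> parcs G)"
    (is "?L \<longleftrightarrow> ?R")
  proof
    assume ?L
    then obtain p where p: "G.awalk u p v" "length p \<le> 2" by blast
    then consider "p = []" | e where "p = [e]" | e f where "p = [e, f]"
      by (cases p rule: remdups_adj.cases) auto
    then show ?R using p(1) by cases (auto simp: G.awalk_simps)
  next
    assume ?R
    then have "G.awalk u [] v \<or> G.awalk u [(u, v)] v \<or> (\<exists>w. G.awalk u [(u, w), (w, v)] v)"
      by (auto simp: G.awalk_simps dest: G.in_arcsD2)
    moreover have "length [(u, w), (w, v)] \<le> 2" "length [(u, v)] \<le> 2"
      "length ([] :: ('a \<times> 'a) list) \<le> 2" for w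
      by simp_all
    ultimately show ?L by blast
  qed
  then show ?thesis
    using graph_dist_le_iff[OF assms, of u v 2] one_le_graph_dist_iff[OF assms, of u v]
    by (auto simp: graph_power_def dest: G.in_arcsD1 G.in_arcsD2)
qed

lemma parcs_path_graph_power_2: "parcs (graph_power (path_graph n) 2) = path_square n"
proof -
  have "pair_wf_digraph (path_graph n)"
    using pair_graph_path_graph[of n]
    by (simp add: pair_graph_def pair_digraph_def pair_fin_digraph_def)
  note power = graph_power_2[OF this]
  have "(i, j) \<in> parcs (graph_power (path_graph n) 2) \<longleftrightarrow> (i, j) \<in> path_square n" for i j
  proof -
    have "(\<exists>w. (i, w) \<in> parcs (path_graph n) \<and> (w, j) \<in> parcs (path_graph n))"
      if "i < n" "j < n" "j = i + 2 \<or> i = j + 2"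
      \<comment> \<open>the midpoint, whichever of the two ends is larger\<close>
      using that by (intro exI[of _ "(i + j) div 2"]) (auto simp: path_graph_def)
    then show ?thesis
      unfolding power by (auto simp: path_graph_def path_square_def)
  qed
  then show ?thesis by auto
qed

lemma num_spanning_trees_path_square:
  "\<tau> (graph_power (path_graph (Suc (Suc m))) 2) = num_trees m"
proof -
  let ?G = "graph_power (path_graph (Suc (Suc m))) 2"
  have verts: "pverts ?G = {..<Suc (Suc m)}" by (simp add: graph_power_def path_graph_def)
  have "pair_graph ?G"
  proof unfold_locales
    show "finite (parcs ?G)"
      unfolding parcs_path_graph_power_2
      by (rule finite_subset[of _ "{..<Suc (Suc m)} \<times> {..<Suc (Suc m)}"]) (auto simp: path_square_def)
  qed (auto simp: verts parcs_path_graph_power_2 path_square_def symmetric_def sym_def)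
  then have "\<tau> ?G = card (spanning_trees (pverts ?G) (parcs ?G))"
    by (rule num_spanning_trees_eq) (simp add: verts lessThan_empty_iff)
  then show ?thesis by (simp add: num_trees_def verts parcs_path_graph_power_2)
qed

section \<open>The generating function\<close>

theorem theorem6p1p1:
  shows "Abs_fps (\<lambda>m. of_nat (\<tau> (graph_power (path_graph (m + 4)) 2)) :: rat) =
    (- 3 * fps_X + 8) / (fps_X ^ 2 - 3 * fps_X + 1)"
proof -
  let ?Q = "fps_X ^ 2 - 3 * fps_X + 1 :: rat fps"
  let ?t = "\<lambda>m. of_nat (num_trees (m + 2)) :: rat"
  let ?f = "Abs_fps ?t"
  have rec: "?t (Suc (Suc m)) + ?t m = 3 * ?t (Suc m)" for m
    using num_trees_recurrence[of "m + 2"] by (simp flip: of_nat_add of_nat_mult)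
  have init: "?t 0 = 8" "?t 1 = 21"
    by (simp_all add: numeral_eq_Suc num_trees_Suc num_two_trees_Suc num_trees_0 num_two_trees_0)
  have "?f * ?Q = - 3 * fps_X + 8"
  proof (rule fps_ext)
    fix n
    \<comment> \<open>multiplication by the variable written as an index shift, to read off coefficients\<close>
    have eq: "?f * ?Q = fps_X * (fps_X * ?f) - fps_const 3 * (fps_X * ?f) + ?f"
      by (simp add: algebra_simps power2_eq_square numeral_fps_const)
    have rhs: "- 3 * fps_X + 8 = fps_const (- 3) * fps_X + fps_const (8 :: rat)"
      by (simp add: numeral_fps_const)
    consider "n = 0" | "n = 1" | m where "n = Suc (Suc m)"
      by (metis One_nat_def not0_implies_Suc)
    then show "fps_nth (?f * ?Q) n = fps_nth (- 3 * fps_X + 8) n"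
      unfolding eq rhs using init rec by cases (auto simp: fps_X_nth algebra_simps)
  qed
  moreover have "fps_nth ?Q 0 \<noteq> 0" by simp
  ultimately have "?f = (- 3 * fps_X + 8) / ?Q"
    by (metis fps_nonzeroI fps_zero_nth nonzero_mult_div_cancel_right)
  moreover have "\<tau> (graph_power (path_graph (m + 4)) 2) = num_trees (m + 2)" for m
    using num_spanning_trees_path_square[of "m + 2"] by (simp add: numeral_eq_Suc)
  ultimately show ?thesis by simp
qed

end
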